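(* For every integer $n \geq 1$, $$c(nK_2) = 2^n \binom{3n}{3,3,\dots,3},$$ where the multinomial coefficient has $n$ lower entries equal to $3$, i.e. it equals $(3n)!/(3!)^n$.
   Context: Graphs are finite, simple and undirected. The elements of a graph $G=(V,E)$ are the members of $V \cup E$. A construction sequence (c-sequence) for $G$ is a listing of all the elements of $G$, without repetitions, such that each edge appears after both of its endpoints. The construction number $c(G)$ is the number of distinct construction sequences for $G$. $nK_2$ is the disjoint union of $n$ edges, i.e. the graph with $2n$ vertices and $n$ pairwise disjoint edges. *)

theory Defs
  imports Complex_Main
begin

type_synonym 'a ugraph = "'a set \<times> 'a set set"

definition verts :: "'a ugraph \<Rightarrow> 'a set" where
  "verts G = fst G"

definition edges :: "'a ugraph \<Rightarrow> 'a set set" where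
  "edges G = snd G"

definition simple_graph :: "'a ugraph \<Rightarrow> bool" where
  "simple_graph G \<longleftrightarrow> finite (verts G) \<and> (\<forall>e\<in>edges G. e \<subseteq> verts G \<and> card e = 2)"

text \<open>The union of vertices and edges is tagged, so that the two kinds of elements
  are always distinct.\<close>

definition elements :: "'a ugraph \<Rightarrow> ('a + 'a set) set" where
  "elements G = verts G <+> edges G"

definition construction_sequence :: "'a ugraph \<Rightarrow> ('a + 'a set) list \<Rightarrow> bool" where
  "construction_sequence G xs \<longleftrightarrow>
     distinct xs \<and> set xs = elements G \<and>
     (\<forall>i<length xs. \<forall>j<length xs. \<forall>v e. xs ! i = Inl v \<and> xs ! j = Inr e \<and> v \<in> e \<longrightarrow> i < j)"

definition construction_number :: "'a ugraph \<Rightarrow> nat" where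
  "construction_number G = card {xs. construction_sequence G xs}"

text \<open>The set of construction sequences of a finite graph is finite, so \<^const>\<open>card\<close> is not
  taking its junk value in \<^const>\<open>construction_number\<close>.\<close>

lemma finite_construction_sequences:
  assumes "simple_graph G"
  shows "finite {xs. construction_sequence G xs}"
proof -
  have "finite (verts G)" "edges G \<subseteq> Pow (verts G)"
    using assms by (auto simp: simple_graph_def)
  then have "finite (elements G)"
    by (auto simp: elements_def intro: finite_subset)
  then have "finite {xs. distinct xs \<and> set xs \<subseteq> elements G}"
    by (rule finite_subset_distinct[THEN finite_subset[rotated]]) auto
  then show ?thesis
    by (rule rev_finite_subset) (auto simp: construction_sequence_def)
qed

text \<open>The graph \<open>n K\<^sub>2\<close> is only determined up to isomorphism, hence a predicate that holds
  of each of its copies.\<close>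

definition is_nK2 :: "nat \<Rightarrow> 'a ugraph \<Rightarrow> bool" where
  "is_nK2 n G \<longleftrightarrow> simple_graph G \<and> card (verts G) = 2 * n \<and> card (edges G) = n \<and>
     pairwise disjnt (edges G)"

lemma is_nK2_exists: "\<exists>G :: (nat \<times> bool) ugraph. is_nK2 n G"
proof
  let ?V = "{..<n} \<times> (UNIV :: bool set)"
  let ?f = "\<lambda>i::nat. {(i, False), (i, True)}"
  have "inj_on ?f {..<n}"
    by (auto simp: inj_on_def doubleton_eq_iff)
  then have "card (?f ` {..<n}) = n"
    by (simp add: card_image)
  then show "is_nK2 n (?V, ?f ` {..<n})"
    by (auto simp: is_nK2_def simple_graph_def verts_def edges_def pairwise_def disjnt_def
        card_cartesian_product)
qed

definition multinomial :: "nat list \<Rightarrow> nat" where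
  "multinomial ks = fact (sum_list ks) div (\<Prod>k\<leftarrow>ks. fact k)"

text \<open>The division is exact.\<close>

lemma prod_fact_dvd_fact_sum: "(\<Prod>k\<leftarrow>ks. fact k) dvd (fact (sum_list ks) :: nat)"
proof (induction ks)
  case (Cons k ks)
  have "(fact k * fact (sum_list ks) :: nat) dvd fact (k + sum_list ks)"
    by (rule fact_fact_dvd_fact)
  with Cons.IH show ?case
    by (auto intro: dvd_trans mult_dvd_mono)
qed simp

lemma multinomial_replicate: "multinomial (replicate n k) = fact (k * n) div fact k ^ n"
  by (simp add: multinomial_def sum_list_replicate prod_list_replicate mult.commute)

end

theory Submission
  imports Defs "HOL-Combinatorics.Multiset_Permutations"
begin

text \<open>
  Each edge \<open>e = {u, v}\<close> of \<open>n K\<^sub>2\<close> gives a triple of elements \<open>{u, v, e}\<close>, these triples are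
  disjoint, and a construction sequence is an arrangement of the \<open>3 n\<close> elements in which \<open>e\<close> comes
  last within its own triple, for every \<open>e\<close>. By symmetry each of the three members of a triple is
  equally likely to come last, independently for disjoint triples, so a proportion \<open>1 / 3 ^ n\<close> of
  the \<open>(3 n)!\<close> arrangements qualifies. Finally \<open>(3 n)! / 3 ^ n = 2 ^ n * ((3 n)! / 6 ^ n)\<close>.

  The symmetry argument is \<open>card_permutations_prescribed_last\<close>, for arbitrary disjoint blocks in a
  finite set; \<open>construction_sequence_iff_last\<close> turns the ordering condition on
  positions into one about the last elements of blocks.
\<close>

text \<open>
  Exchanging two members of a block throughout a list permutes the possible last elements of that
  block. A block disjoint from it does not notice the exchange, which is the content of
  \<open>filter_map_transpose_disjoint\<close>. Hence the exchange respects the conditions on all other blocks.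
\<close>

lemma last_filter_map_transpose:
  assumes "a \<in> B" "b \<in> B" "B \<inter> set xs \<noteq> {}"
  shows "last (filter (\<lambda>y. y \<in> B) (map (transpose a b) xs)) =
         transpose a b (last (filter (\<lambda>y. y \<in> B) xs))"
proof -
  have "transpose a b y \<in> B \<longleftrightarrow> y \<in> B" for y
    using assms(1,2) by (auto simp: transpose_def)
  then have "filter (\<lambda>y. y \<in> B) (map (transpose a b) xs) =
      map (transpose a b) (filter (\<lambda>y. y \<in> B) xs)"
    by (simp add: filter_map o_def)
  moreover have "filter (\<lambda>y. y \<in> B) xs \<noteq> []"
    using assms(3) by (auto simp: filter_empty_conv)
  ultimately show ?thesis
    by (simp add: last_map)
qed

lemma filter_map_transpose_disjoint:
  assumes "a \<notin> C" "b \<notin> C"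
  shows "filter (\<lambda>y. y \<in> C) (map (transpose a b) xs) = filter (\<lambda>y. y \<in> C) xs"
  using assms by (induction xs) (auto simp: transpose_def)

lemma map_transpose_in_permutations_of_set:
  assumes "xs \<in> permutations_of_set S" "a \<in> S" "b \<in> S"
  shows "map (transpose a b) xs \<in> permutations_of_set S"
  using assms by (auto simp: permutations_of_set_def distinct_map)

text \<open>
  The blocks are treated one at a time. Among the arrangements that satisfy the conditions for the
  earlier blocks, those with a given last element in the new block \<open>B i\<close> are equinumerous for
  all \<open>card (B i)\<close> choices of that element, so prescribing it divides the count by \<open>card (B i)\<close>.
\<close>

lemma card_permutations_prescribed_last:
  fixes S :: "'b set" and I :: "'i set"
  assumes "finite S" "finite I"
    and "\<And>i. i \<in> I \<Longrightarrow> B i \<subseteq> S" "\<And>i. i \<in> I \<Longrightarrow> m i \<in> B i"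
    and "disjoint_family_on B I"
  shows "card {xs \<in> permutations_of_set S. \<forall>i\<in>I. last (filter (\<lambda>y. y \<in> B i) xs) = m i} *
         (\<Prod>i\<in>I. card (B i)) = fact (card S)"
  using assms(2-5)
proof (induction I rule: finite_induct)
  case empty
  then show ?case
    using assms(1) by simp
next
  case (insert i I)
  define P where "P = {xs \<in> permutations_of_set S. \<forall>j\<in>I. last (filter (\<lambda>y. y \<in> B j) xs) = m j}"
  define Q where "Q x = {xs \<in> P. last (filter (\<lambda>y. y \<in> B i) xs) = x}" for x
  have B: "B i \<subseteq> S" and m: "m i \<in> B i"
    using insert.prems by auto
  have finB: "finite (B i)"
    using B assms(1) finite_subset by blast
  have finP: "finite P"
    by (simp add: P_def)
  have meets: "B i \<inter> set xs \<noteq> {}" if "xs \<in> P" for xs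
    using that B m by (auto simp: P_def permutations_of_set_def)
  have swap_mem: "map (transpose x y) xs \<in> Q y" if "x \<in> B i" "y \<in> B i" "xs \<in> Q x" for x y xs
  proof -
    have "x \<notin> B j" "y \<notin> B j" if "j \<in> I" for j
      using \<open>x \<in> B i\<close> \<open>y \<in> B i\<close> that insert.prems(3) insert.hyps(2)
      by (auto simp: disjoint_family_on_def)
    moreover have "x \<in> S" "y \<in> S"
      using that B by auto
    ultimately have "map (transpose x y) xs \<in> P"
      using \<open>xs \<in> Q x\<close>
      by (auto simp: Q_def P_def filter_map_transpose_disjoint
          intro!: map_transpose_in_permutations_of_set)
    moreover have "last (filter (\<lambda>z. z \<in> B i) (map (transpose x y) xs)) = y"
      using that meets[of xs] by (subst last_filter_map_transpose) (auto simp: Q_def)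
    ultimately show ?thesis
      by (simp add: Q_def)
  qed
  have card_Q: "card (Q x) = card (Q (m i))" if "x \<in> B i" for x
  proof (rule bij_betw_same_card)
    have inv: "map (transpose a b) (map (transpose b a) xs) = xs" for a b and xs :: "'b list"
      by (simp add: transpose_commute[of b a])
    show "bij_betw (map (transpose x (m i))) (Q x) (Q (m i))"
      by (rule bij_betw_byWitness[where f' = "map (transpose (m i) x)"])
        (use swap_mem[OF that m] swap_mem[OF m that] in \<open>auto simp: inv simp del: map_map\<close>)
  qed
  have P_eq: "P = (\<Union>x\<in>B i. Q x)"
  proof -
    have "last (filter (\<lambda>y. y \<in> B i) xs) \<in> B i" if "xs \<in> P" for xs
    proof -
      have "filter (\<lambda>y. y \<in> B i) xs \<noteq> []"
        using meets[OF that] by (auto simp: filter_empty_conv)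
      then show ?thesis
        using last_in_set by fastforce
    qed
    then show ?thesis
      by (auto simp: Q_def)
  qed
  have "card P = (\<Sum>x\<in>B i. card (Q x))"
    unfolding P_eq
  proof (intro card_UN_disjoint ballI impI)
    show "finite (Q x)" for x
      using finP by (simp add: Q_def)
  qed (auto simp: finB Q_def)
  also have "\<dots> = card (B i) * card (Q (m i))"
    using card_Q by simp
  finally have "card P = card (B i) * card (Q (m i))" .
  moreover have "card P * (\<Prod>j\<in>I. card (B j)) = fact (card S)"
    unfolding P_def using insert.prems
    by (intro insert.IH) (auto simp: disjoint_family_on_def)
  moreover have "Q (m i) = {xs \<in> permutations_of_set S.
      \<forall>j\<in>insert i I. last (filter (\<lambda>y. y \<in> B j) xs) = m j}"
    by (auto simp: Q_def P_def)
  ultimately show ?case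
    using insert.hyps by (simp add: mult.commute mult.left_commute)
qed

lemma last_filter_eq_iff_nth:
  assumes "distinct xs" "x \<in> set xs" "x \<in> B"
  shows "last (filter (\<lambda>y. y \<in> B) xs) = x \<longleftrightarrow>
    (\<forall>i<length xs. \<forall>j<length xs. xs ! i \<in> B \<and> xs ! j = x \<longrightarrow> i \<le> j)"
proof -
  obtain k where k: "k < length xs" "xs ! k = x"
    using assms(2) by (auto simp: in_set_conv_nth)
  define zs where "zs = drop (Suc k) xs"
  have xs: "xs = take k xs @ x # zs"
    using id_take_nth_drop[OF k(1)] k(2) by (simp add: zs_def)
  have "x \<notin> set zs"
    using assms(1) by (subst (asm) xs) auto
  then have "last (filter (\<lambda>y. y \<in> B) xs) = x \<longleftrightarrow> filter (\<lambda>y. y \<in> B) zs = []"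
    using assms(3) last_in_set[of "filter (\<lambda>y. y \<in> B) zs"] by (subst xs) auto
  also have "\<dots> \<longleftrightarrow> (\<forall>i<length xs. k < i \<longrightarrow> xs ! i \<notin> B)"
  proof -
    have "filter (\<lambda>y. y \<in> B) zs = [] \<longleftrightarrow> (\<forall>d<length xs - Suc k. xs ! (Suc k + d) \<notin> B)"
      using k(1) by (simp add: filter_empty_conv all_set_conv_all_nth zs_def)
    also have "\<dots> \<longleftrightarrow> (\<forall>i<length xs. k < i \<longrightarrow> xs ! i \<notin> B)"
    proof (intro iffI allI impI)
      fix i
      assume "\<forall>d<length xs - Suc k. xs ! (Suc k + d) \<notin> B" "i < length xs" "k < i"
      then show "xs ! i \<notin> B"
        by (auto dest: spec[of _ "i - Suc k"])
    qed auto
    finally show ?thesis .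
  qed
  also have "\<dots> \<longleftrightarrow> (\<forall>i<length xs. \<forall>j<length xs. xs ! i \<in> B \<and> xs ! j = x \<longrightarrow> i \<le> j)"
  proof -
    have "xs ! j = x \<longleftrightarrow> j = k" if "j < length xs" for j
      using nth_eq_iff_index_eq[OF assms(1) that k(1)] k(2) by simp
    then show ?thesis
      using k(1) linorder_not_less by blast
  qed
  finally show ?thesis .
qed

text \<open>
  Stated through \<open>filter\<close>, the condition on an edge depends only on the elements of its own block,
  so it can be tracked under exchanges in the other blocks.
\<close>

lemma construction_sequence_iff_last:
  "construction_sequence G xs \<longleftrightarrow>
     xs \<in> permutations_of_set (elements G) \<and>
     (\<forall>e\<in>edges G. last (filter (\<lambda>y. y \<in> insert (Inr e) (Inl ` e)) xs) = Inr e)"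
proof (cases "xs \<in> permutations_of_set (elements G)")
  case False
  then show ?thesis
    by (auto simp: construction_sequence_def permutations_of_set_def)
next
  case True
  then have xs: "distinct xs" "set xs = elements G"
    by (auto simp: permutations_of_set_def)
  have edge: "e \<in> edges G \<longleftrightarrow> Inr e \<in> set xs" for e
    by (auto simp: xs(2) elements_def)
  have "(\<forall>e\<in>edges G. last (filter (\<lambda>y. y \<in> insert (Inr e) (Inl ` e)) xs) = Inr e) \<longleftrightarrow>
      (\<forall>e\<in>edges G. \<forall>i<length xs. \<forall>j<length xs.
        xs ! i \<in> insert (Inr e) (Inl ` e) \<and> xs ! j = Inr e \<longrightarrow> i \<le> j)"
    using xs(1) edge by (intro ball_cong refl last_filter_eq_iff_nth) auto
  \<comment> \<open>The edge itself lies in its block, hence \<open>i \<le> j\<close> there; equality occurs for the edge only.\<close>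
  also have "\<dots> \<longleftrightarrow> (\<forall>i<length xs. \<forall>j<length xs. \<forall>v e.
      xs ! i = Inl v \<and> xs ! j = Inr e \<and> v \<in> e \<longrightarrow> i < j)" (is "?L \<longleftrightarrow> ?R")
  proof
    assume L: ?L
    show ?R
    proof (intro allI impI, elim conjE)
      fix i j v e
      assume *: "i < length xs" "j < length xs" "xs ! i = Inl v" "xs ! j = Inr e" "v \<in> e"
      then have "e \<in> edges G"
        using edge nth_mem by metis
      then have "i \<le> j"
        using L * by auto
      then show "i < j"
        using * by (cases "i = j") auto
    qed
  next
    assume R: ?R
    show ?L
    proof (intro ballI allI impI, elim conjE)
      fix e i j
      assume *: "i < length xs" "j < length xs" "xs ! i \<in> insert (Inr e) (Inl ` e)" "xs ! j = Inr e"
      from *(3) show "i \<le> j"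
      proof
        assume "xs ! i = Inr e"
        then show ?thesis
          using nth_eq_iff_index_eq[OF xs(1) *(1,2)] *(4) by simp
      next
        assume "xs ! i \<in> Inl ` e"
        then obtain v where "xs ! i = Inl v" "v \<in> e"
          by blast
        then show ?thesis
          using R *(1,2,4) less_imp_le by blast
      qed
    qed
  qed
  finally show ?thesis
    using True xs by (simp add: construction_sequence_def)
qed

theorem theorem4:
  fixes n :: nat and G :: "'a ugraph"
  assumes "n \<ge> 1" and "is_nK2 n G"
  shows "construction_number G = 2 ^ n * multinomial (replicate n 3)"
proof -
  define B :: "'a set \<Rightarrow> ('a + 'a set) set" where "B e = insert (Inr e) (Inl ` e)" for e
  have G: "finite (verts G)" "\<And>e. e \<in> edges G \<Longrightarrow> e \<subseteq> verts G \<and> card e = 2"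
    "card (verts G) = 2 * n" "card (edges G) = n" "pairwise disjnt (edges G)"
    using assms(2) by (auto simp: is_nK2_def simple_graph_def)
  have fin: "finite (edges G)"
    using G(1,2) by (auto intro: finite_subset[of _ "Pow (verts G)"])
  have card_elements: "card (elements G) = 3 * n"
    using G fin by (simp add: elements_def card_Plus)
  have card_B: "card (B e) = 3" if "e \<in> edges G" for e
  proof -
    have "finite e"
      using G(1) G(2)[OF that] finite_subset by blast
    then show ?thesis
      using G(2)[OF that] by (subst B_def, subst card_insert_disjoint) (auto simp: card_image)
  qed
  have "construction_number G * (\<Prod>e\<in>edges G. card (B e)) = fact (card (elements G))"
    unfolding construction_number_def construction_sequence_iff_last B_def[symmetric]
  proof (rule card_permutations_prescribed_last)
    show "finite (elements G)"
      using G(1) fin by (simp add: elements_def)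
    show "B e \<subseteq> elements G" if "e \<in> edges G" for e
      using G(2)[OF that] that by (auto simp: B_def elements_def)
    show "disjoint_family_on B (edges G)"
      using G(5) by (auto simp: disjoint_family_on_def B_def pairwise_def disjnt_def)
  qed (auto simp: fin B_def)
  then have "construction_number G * 3 ^ n = fact (3 * n)"
    using card_B G(4) card_elements by simp
  also have "\<dots> = multinomial (replicate n 3) * 6 ^ n"
    using prod_fact_dvd_fact_sum[of "replicate n 3"]
    by (simp add: multinomial_def sum_list_replicate prod_list_replicate fact_numeral mult.commute)
  also have "\<dots> = 2 ^ n * multinomial (replicate n 3) * 3 ^ n"
    by (simp flip: power_mult_distrib)
  finally show ?thesis
    by simp
qed

end
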